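(* Assume that $r_{ij}\ne0$ for all $i\neq j$ and $c_2=r_{21}+r_{23}$. Then $I^*=(y^{r_{12}}z^{r_{13}},\,y^{c_2}-x^{r_{21}}z^{r_{23}},\,z^{c_3})$.
   Context: Let $K$ be a field and let $n_1<n_2<n_3$ be positive integers with $\gcd(n_1,n_2,n_3)=1$ that minimally generate the numerical semigroup $H=\langle n_1,n_2,n_3\rangle$. Let $S=K[x,y,z]$ with the standard grading, and let $I=I_H$ be the kernel of $S\to K[t]$, $x\mapsto t^{n_1}$, $y\mapsto t^{n_2}$, $z\mapsto t^{n_3}$. For nonzero $f\in S$, $f^*$ is its homogeneous component of smallest degree, and $I^*=(f^*\mid 0\neq f\in I)$. Let $c_1,c_2,c_3$ be the smallest positive integers such that $c_1n_1\in\langle n_2,n_3\rangle$, $c_2n_2\in\langle n_1,n_3\rangle$, $c_3n_3\in\langle n_1,n_2\rangle$, and let $r_{ij}$ be non-negative integers with $c_1n_1=r_{12}n_2+r_{13}n_3$, $c_2n_2=r_{21}n_1+r_{23}n_3$, $c_3n_3=r_{31}n_1+r_{32}n_2$. (The condition that all $r_{ij}$ are nonzero is the case where $I$ is not a complete intersection.) *)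

theory Defs
  imports
    "HOL-Library.Poly_Mapping"
    "HOL-Library.Product_Plus"
    "HOL-Computational_Algebra.Polynomial"
begin

text \<open>The polynomial ring \<open>K[x,y,z]\<close> as the monoid algebra of \<open>\<nat> \<times> \<nat> \<times> \<nat>\<close>: the exponent
  vector \<open>(a, b, c)\<close> stands for the monomial \<open>x\<^sup>a y\<^sup>b z\<^sup>c\<close>, and multiplication is convolution.\<close>

type_synonym 'k poly3 = "(nat \<times> nat \<times> nat) \<Rightarrow>\<^sub>0 'k"

definition X :: "'k::field poly3" where "X = Poly_Mapping.single (1, 0, 0) 1"
definition Y :: "'k::field poly3" where "Y = Poly_Mapping.single (0, 1, 0) 1"
definition Z :: "'k::field poly3" where "Z = Poly_Mapping.single (0, 0, 1) 1"

fun mdeg :: "nat \<times> nat \<times> nat \<Rightarrow> nat" where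
  "mdeg (a, b, c) = a + b + c"

text \<open>Homogeneous components for the standard grading; \<open>order3 0\<close> is unspecified.\<close>

definition hom_component :: "nat \<Rightarrow> 'k::field poly3 \<Rightarrow> 'k poly3" where
  "hom_component d f =
     (\<Sum>m \<in> {m \<in> Poly_Mapping.keys f. mdeg m = d}. Poly_Mapping.single m (Poly_Mapping.lookup f m))"

definition order3 :: "'k::field poly3 \<Rightarrow> nat" where
  "order3 f = (LEAST d. hom_component d f \<noteq> 0)"

definition initial_form :: "'k::field poly3 \<Rightarrow> 'k poly3" where
  "initial_form f = hom_component (order3 f) f"

text \<open>The ideal generated by \<open>A\<close>: the span of \<open>A\<close> in the ring regarded as a module over itself.\<close>

definition ideal_gen :: "'a::comm_ring_1 set \<Rightarrow> 'a set" where
  "ideal_gen A = module.span (*) A"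

lemma module_self: "module ((*) :: 'a::comm_ring_1 \<Rightarrow> 'a \<Rightarrow> 'a)"
  by unfold_locales (simp_all add: algebra_simps)

definition initial_ideal :: "'k::field poly3 set \<Rightarrow> 'k poly3 set" where
  "initial_ideal I = ideal_gen {initial_form f | f. f \<in> I \<and> f \<noteq> 0}"

text \<open>The substitution \<open>x \<mapsto> t\<^bsup>n\<^sub>1\<^esup>\<close>, \<open>y \<mapsto> t\<^bsup>n\<^sub>2\<^esup>\<close>, \<open>z \<mapsto> t\<^bsup>n\<^sub>3\<^esup>\<close>, where \<open>monom 1 n\<close> is \<open>t\<^sup>n\<close>.\<close>

definition subst_t :: "nat \<Rightarrow> nat \<Rightarrow> nat \<Rightarrow> 'k::field poly3 \<Rightarrow> 'k poly" where
  "subst_t n1 n2 n3 f =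
     (\<Sum>(a, b, c) \<in> Poly_Mapping.keys f.
        smult (Poly_Mapping.lookup f (a, b, c)) (monom 1 n1 ^ a * monom 1 n2 ^ b * monom 1 n3 ^ c))"

definition toric_ideal :: "nat \<Rightarrow> nat \<Rightarrow> nat \<Rightarrow> 'k::field poly3 set" where
  "toric_ideal n1 n2 n3 = {f. subst_t n1 n2 n3 f = 0}"

inductive_set semigroup_gen :: "nat set \<Rightarrow> nat set" for A :: "nat set" where
  zero: "0 \<in> semigroup_gen A"
| add: "a \<in> A \<Longrightarrow> s \<in> semigroup_gen A \<Longrightarrow> a + s \<in> semigroup_gen A"

definition minimally_generates :: "nat set \<Rightarrow> nat set \<Rightarrow> bool" where
  "minimally_generates A H \<longleftrightarrow> semigroup_gen A = H \<and> (\<forall>B. B \<subset> A \<longrightarrow> semigroup_gen B \<noteq> H)"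

definition least_mult :: "nat \<Rightarrow> nat set \<Rightarrow> nat" where
  "least_mult n A = (LEAST c. 0 < c \<and> c * n \<in> semigroup_gen A)"

text \<open>\<open>subst_t\<close> is a \<open>K\<close>-algebra homomorphism with the stated values on the variables; on constants
  this is the case \<open>a = b = c = 0\<close> of the first lemma.\<close>

lemma subst_t_single:
  "subst_t n1 n2 n3 (Poly_Mapping.single (a, b, c) u) =
     smult u (monom 1 n1 ^ a * monom 1 n2 ^ b * monom 1 n3 ^ c)"
  by (cases "u = 0") (simp_all add: subst_t_def)

lemma subst_t_X: "subst_t n1 n2 n3 X = monom 1 n1"
  and subst_t_Y: "subst_t n1 n2 n3 Y = monom 1 n2"
  and subst_t_Z: "subst_t n1 n2 n3 Z = monom 1 n3"
  by (simp_all add: X_def Y_def Z_def subst_t_single)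

lemma subst_t_add: "subst_t n1 n2 n3 (f + g) = subst_t n1 n2 n3 f + subst_t n1 n2 n3 g"
  unfolding subst_t_def
  using setsum_keys_plus_distrib[where p = f and q = g and
      f = "\<lambda>(a, b, c) u. smult u (monom 1 n1 ^ a * monom 1 n2 ^ b * monom 1 n3 ^ c)"]
  by (simp add: case_prod_unfold smult_add_left)

lemma subst_t_mult: "subst_t n1 n2 n3 (f * g) = subst_t n1 n2 n3 f * subst_t n1 n2 n3 g"
proof -
  let ?s = "subst_t n1 n2 n3"
  have decomp: "p = (\<Sum>m \<in> Poly_Mapping.keys p. Poly_Mapping.single m (Poly_Mapping.lookup p m))"
    for p :: "'a poly3"
    by (rule poly_mapping_eqI)
      (auto simp: lookup_sum lookup_single when_def in_keys_iff)
  have s_sum: "?s (sum h A) = (\<Sum>i\<in>A. ?s (h i))" if "finite A"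
    for h :: "nat \<times> nat \<times> nat \<Rightarrow> 'a poly3" and A
    using that by induction (simp_all add: subst_t_add, simp add: subst_t_def)
  have single: "?s (Poly_Mapping.single m u * Poly_Mapping.single k v)
      = ?s (Poly_Mapping.single m u) * ?s (Poly_Mapping.single k v)"
    for m k :: "nat \<times> nat \<times> nat" and u v :: 'a
    by (cases m; cases k) (simp add: mult_single subst_t_single power_add mult_ac)
  have "?s (f * g) = ?s ((\<Sum>m \<in> Poly_Mapping.keys f. Poly_Mapping.single m (Poly_Mapping.lookup f m)) *
      (\<Sum>k \<in> Poly_Mapping.keys g. Poly_Mapping.single k (Poly_Mapping.lookup g k)))"
    by (simp flip: decomp)
  also have "\<dots> = ?s (\<Sum>m \<in> Poly_Mapping.keys f. Poly_Mapping.single m (Poly_Mapping.lookup f m)) *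
      ?s (\<Sum>k \<in> Poly_Mapping.keys g. Poly_Mapping.single k (Poly_Mapping.lookup g k))"
    by (simp only: s_sum finite_keys sum_product single)
  finally show ?thesis by (simp flip: decomp)
qed

end

theory Submission
  imports Defs
begin

text \<open>Write \<open>J\<close> for the ideal on the right-hand side. Up to sign its generators are the initial
  forms of the binomials \<open>y\<^bsup>r\<^sub>1\<^sub>2\<^esup> z\<^bsup>r\<^sub>1\<^sub>3\<^esup> - x\<^bsup>c\<^sub>1\<^esup>\<close>,
  \<open>y\<^bsup>c\<^sub>2\<^esup> - x\<^bsup>r\<^sub>2\<^sub>1\<^esup> z\<^bsup>r\<^sub>2\<^sub>3\<^esup>\<close> and \<open>z\<^bsup>c\<^sub>3\<^esup> - x\<^bsup>r\<^sub>3\<^sub>1\<^esup> y\<^bsup>r\<^sub>3\<^sub>2\<^esup>\<close> of the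
  toric ideal, because \<open>n\<^sub>1 < n\<^sub>2 < n\<^sub>3\<close> forces \<open>r\<^sub>1\<^sub>2 + r\<^sub>1\<^sub>3 < c\<^sub>1\<close> and \<open>c\<^sub>3 < r\<^sub>3\<^sub>1 + r\<^sub>3\<^sub>2\<close>, while
  the second binomial is homogeneous by assumption. So \<open>J\<close> is contained in the initial ideal.

  For the converse, use the three binomials as rewriting rules from left to right. They keep the
  weight \<open>a n\<^sub>1 + b n\<^sub>2 + c n\<^sub>3\<close> of a monomial \<open>x\<^sup>a y\<^sup>b z\<^sup>c\<close>. The first and the third raise the degree
  and apply only to monomials of \<open>J\<close>; the second keeps the degree and the residue class modulo \<open>J\<close>.
  Rewriting terminates (\<open>exists_normal_form\<close>), and by the minimality of the \<open>c\<^sub>i\<close> a weight is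
  attained by at most one irreducible monomial (\<open>normal_unique\<close>). Hence the
  irreducible monomial \<open>p\<close> of weight \<open>w\<close> has the largest degree among all monomials of weight \<open>w\<close>;
  those of smaller degree lie in \<open>J\<close>, and those of the same degree are congruent to \<open>p\<close>.

  Now let \<open>f\<close> be a nonzero element of the toric ideal, of order \<open>d\<close>. Modulo \<open>J\<close>, its initial
  form is a combination of those irreducible monomials \<open>p\<close> that have degree \<open>d\<close>. For such a \<open>p\<close> all
  terms of \<open>f\<close> of the same weight have degree exactly \<open>d\<close>, being squeezed between the order of \<open>f\<close>
  and the degree of \<open>p\<close>. So the coefficient of \<open>p\<close> is the sum of all coefficients of \<open>f\<close> in that
  weight, which is a coefficient of the image of \<open>f\<close> in \<open>K[t]\<close> and therefore zero.\<close>

section \<open>Ideals and monomials\<close>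

lemma ideal_gen_base: "a \<in> A \<Longrightarrow> a \<in> ideal_gen A"
  unfolding ideal_gen_def by (rule module.span_base[OF module_self])

lemma ideal_gen_zero: "0 \<in> ideal_gen A"
  unfolding ideal_gen_def by (rule module.span_zero[OF module_self])

lemma ideal_gen_add: "a \<in> ideal_gen A \<Longrightarrow> b \<in> ideal_gen A \<Longrightarrow> a + b \<in> ideal_gen A"
  unfolding ideal_gen_def by (rule module.span_add[OF module_self])

lemma ideal_gen_mult: "a \<in> ideal_gen A \<Longrightarrow> u * a \<in> ideal_gen A"
  unfolding ideal_gen_def by (rule module.span_scale[OF module_self])

lemma ideal_gen_sum: "(\<And>i. i \<in> B \<Longrightarrow> h i \<in> ideal_gen A) \<Longrightarrow> sum h B \<in> ideal_gen A"
  unfolding ideal_gen_def by (rule module.span_sum[OF module_self])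

lemma ideal_gen_subset: "A \<subseteq> ideal_gen B \<Longrightarrow> ideal_gen A \<subseteq> ideal_gen B"
  unfolding ideal_gen_def
  by (rule module.span_minimal[OF module_self _ module.subspace_span[OF module_self]])

abbreviation monomial :: "nat \<times> nat \<times> nat \<Rightarrow> 'k::field poly3" where
  "monomial m \<equiv> Poly_Mapping.single m 1"

lemma monomial_mult: "monomial (a, b, c) * monomial (a', b', c') = monomial (a + a', b + b', c + c')"
  by (simp add: mult_single)

lemma X_power: "X ^ n = monomial (n, 0, 0)"
  by (induction n) (simp_all add: X_def monomial_mult zero_prod_def flip: single_one)

lemma Y_power: "Y ^ n = monomial (0, n, 0)"
  by (induction n) (simp_all add: Y_def monomial_mult zero_prod_def flip: single_one)

lemma Z_power: "Z ^ n = monomial (0, 0, n)"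
  by (induction n) (simp_all add: Z_def monomial_mult zero_prod_def flip: single_one)

section \<open>Initial forms\<close>

lemma lookup_hom_component:
  "Poly_Mapping.lookup (hom_component d f) m = (if mdeg m = d then Poly_Mapping.lookup f m else 0)"
  by (auto simp: hom_component_def lookup_sum lookup_single when_def in_keys_iff)

lemma order3_le_mdeg:
  assumes "m \<in> Poly_Mapping.keys f"
  shows "order3 f \<le> mdeg m"
proof -
  have "Poly_Mapping.lookup (hom_component (mdeg m) f) m \<noteq> 0"
    using assms by (simp add: lookup_hom_component in_keys_iff)
  then have "hom_component (mdeg m) f \<noteq> 0" by auto
  then show ?thesis unfolding order3_def by (rule Least_le)
qed

lemma order3_eqI:
  assumes "m \<in> Poly_Mapping.keys f" and "\<And>k. k \<in> Poly_Mapping.keys f \<Longrightarrow> mdeg m \<le> mdeg k"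
  shows "order3 f = mdeg m"
  unfolding order3_def
proof (rule Least_equality)
  have "Poly_Mapping.lookup (hom_component (mdeg m) f) m \<noteq> 0"
    using assms(1) by (simp add: lookup_hom_component in_keys_iff)
  then show "hom_component (mdeg m) f \<noteq> 0" by auto
next
  fix d assume "hom_component d f \<noteq> 0"
  then obtain k where "Poly_Mapping.lookup (hom_component d f) k \<noteq> 0"
    by (metis lookup_zero poly_mapping_eqI)
  then have "mdeg k = d" "k \<in> Poly_Mapping.keys f"
    by (simp_all add: lookup_hom_component in_keys_iff split: if_splits)
  then show "mdeg m \<le> d" using assms(2) by blast
qed

lemma initial_form_binomial:
  assumes "m \<noteq> k" "mdeg m \<le> mdeg k"
  shows "initial_form (monomial m - monomial k :: 'k::field poly3)
    = (if mdeg m < mdeg k then monomial m else monomial m - monomial k)"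
proof -
  have "order3 (monomial m - monomial k :: 'k poly3) = mdeg m"
    using assms
    by (intro order3_eqI) (auto simp: in_keys_iff lookup_minus lookup_single when_def split: if_splits)
  then show ?thesis
    using assms unfolding initial_form_def
    by (intro poly_mapping_eqI) (auto simp: lookup_hom_component lookup_minus lookup_single when_def)
qed

section \<open>The grading by weight\<close>

fun weight :: "nat \<Rightarrow> nat \<Rightarrow> nat \<Rightarrow> nat \<times> nat \<times> nat \<Rightarrow> nat" where
  "weight n1 n2 n3 (a, b, c) = a * n1 + b * n2 + c * n3"

lemma coeff_subst_t:
  "coeff (subst_t n1 n2 n3 f) w
    = (\<Sum>m \<in> {m \<in> Poly_Mapping.keys f. weight n1 n2 n3 m = w}. Poly_Mapping.lookup f m)"
proof -
  have "coeff (subst_t n1 n2 n3 f) w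
      = (\<Sum>m \<in> Poly_Mapping.keys f. if weight n1 n2 n3 m = w then Poly_Mapping.lookup f m else 0)"
    unfolding subst_t_def coeff_sum
    by (rule sum.cong) (auto simp: monom_power mult_monom mult.commute)
  then show ?thesis by (simp add: sum.inter_filter)
qed

lemma binomial_in_toric_ideal:
  assumes "weight n1 n2 n3 m = weight n1 n2 n3 k"
  shows "monomial m - monomial k \<in> (toric_ideal n1 n2 n3 :: 'k::field poly3 set)"
proof -
  have image: "subst_t n1 n2 n3 (Poly_Mapping.single p u) = monom u (weight n1 n2 n3 p)" for p and u :: 'k
    by (cases p) (simp add: subst_t_single monom_power mult_monom smult_monom algebra_simps)
  have "subst_t n1 n2 n3 (monomial m + Poly_Mapping.single k (- 1) :: 'k poly3) = 0"
    using assms by (simp only: subst_t_add image add_monom) simp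
  then show ?thesis by (simp add: toric_ideal_def single_uminus)
qed

lemma binomial_initial_form_in_initial_ideal:
  assumes "m \<noteq> k" "weight n1 n2 n3 m = weight n1 n2 n3 k"
  shows "initial_form (monomial m - monomial k) \<in> initial_ideal (toric_ideal n1 n2 n3 :: 'k::field poly3 set)"
proof -
  have "Poly_Mapping.lookup (monomial m - monomial k :: 'k poly3) m \<noteq> 0"
    using assms(1) by (simp add: lookup_minus lookup_single when_def)
  then have "monomial m - monomial k \<noteq> (0 :: 'k poly3)" by auto
  then show ?thesis
    unfolding initial_ideal_def using binomial_in_toric_ideal[OF assms(2)]
    by (intro ideal_gen_base) blast
qed

lemma semigroup_gen_pair: "i * p + j * q \<in> semigroup_gen {p, q}"
proof (induction i)
  case 0
  show ?case
  proof (induction j)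
    case (Suc j)
    then show ?case using semigroup_gen.add[of q "{p, q}" "0 * p + j * q"] by simp
  qed (simp add: semigroup_gen.zero)
next
  case (Suc i)
  then show ?case using semigroup_gen.add[of p "{p, q}" "i * p + j * q"] by (simp add: algebra_simps)
qed

lemma least_mult_le:
  assumes "0 < c" "c * n = i * p + j * q"
  shows "least_mult n {p, q} \<le> c"
  unfolding least_mult_def using assms semigroup_gen_pair by (intro Least_le) simp

section \<open>Irreducible monomials\<close>

text \<open>The minimality of the \<open>c\<^sub>i\<close> enters as a bound on the exponent of any nontrivial power of one variable
  whose weight is also attained by a monomial in the other two.\<close>

locale homogeneous_second_relation =
  fixes n1 n2 n3 c1 c2 c3 r12 r13 r21 r23 r31 r32 :: nat
  assumes n_order: "0 < n1" "n1 < n2" "n2 < n3"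
    and c1_minimal: "\<And>a b c. 0 < a \<Longrightarrow> a * n1 = b * n2 + c * n3 \<Longrightarrow> c1 \<le> a"
    and c2_minimal: "\<And>a b c. 0 < b \<Longrightarrow> b * n2 = a * n1 + c * n3 \<Longrightarrow> c2 \<le> b"
    and c3_minimal: "\<And>a b c. 0 < c \<Longrightarrow> c * n3 = a * n1 + b * n2 \<Longrightarrow> c3 \<le> c"
    and rel1: "c1 * n1 = r12 * n2 + r13 * n3"
    and rel2: "c2 * n2 = r21 * n1 + r23 * n3"
    and rel3: "c3 * n3 = r31 * n1 + r32 * n2"
    and r_pos: "0 < r12" "0 < r13" "0 < r21" "0 < r23" "0 < r31" "0 < r32"
    and homogeneous: "c2 = r21 + r23"
begin

abbreviation wt :: "nat \<times> nat \<times> nat \<Rightarrow> nat" where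
  "wt \<equiv> weight n1 n2 n3"

definition candidate :: "'k::field poly3 set" where
  "candidate = ideal_gen {Y ^ r12 * Z ^ r13, Y ^ c2 - X ^ r21 * Z ^ r23, Z ^ c3}"

definition normal :: "nat \<times> nat \<times> nat \<Rightarrow> bool" where
  "normal = (\<lambda>(a, b, c). b < c2 \<and> c < c3 \<and> (b < r12 \<or> c < r13))"

lemma degree_rel1: "r12 + r13 < c1"
proof -
  have "(r12 + r13) * n1 < r12 * n2 + r13 * n3"
    using n_order r_pos by (auto simp: distrib_right intro!: add_strict_mono)
  then show ?thesis by (simp add: mult_less_cancel2 flip: rel1)
qed

lemma degree_rel3: "c3 < r31 + r32"
proof -
  have "r31 * n1 + r32 * n2 < (r31 + r32) * n3"
    using n_order r_pos by (auto simp: distrib_right intro!: add_strict_mono)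
  then show ?thesis by (simp add: mult_less_cancel2 flip: rel3)
qed

text \<open>A nontrivial power of \<open>x\<close> of the same weight as \<open>y\<^sup>i z\<^sup>j\<close> has exponent at least \<open>c\<^sub>1\<close>, so part of it can be traded
  for \<open>y\<^bsup>r\<^sub>1\<^sub>2\<^esup> z\<^bsup>r\<^sub>1\<^sub>3\<^esup>\<close>. As \<open>y\<^sup>i z\<^sup>j\<close> is not divisible by the latter, cancelling leaves a pure power
  of \<open>y\<close> or of \<open>z\<close> on one side, with too small an exponent.\<close>

lemma normal_no_x_power_of_equal_weight:
  assumes eq: "k * n1 = i * n2 + j * n3" and nrm: "normal (a, i, j)"
  shows "k = 0"
proof (rule ccontr)
  assume "k \<noteq> 0"
  then have "c1 \<le> k" using eq by (intro c1_minimal) auto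
  then obtain e where e: "k = c1 + e" using le_Suc_ex by blast
  have bal: "e * n1 + r12 * n2 + r13 * n3 = i * n2 + j * n3"
    using eq rel1 by (simp add: e algebra_simps)
  consider "i < r12" | "r12 \<le> i" "j < r13" using nrm unfolding normal_def by fastforce
  then show False
  proof cases
    case 1
    then obtain u where u: "r12 = i + u" "0 < u" using less_imp_add_positive by blast
    have "e * n1 + u * n2 + r13 * n3 = j * n3" using bal by (simp add: u algebra_simps)
    moreover have "0 < u * n2" using u n_order by simp
    ultimately have "r13 * n3 < j * n3" by linarith
    then have "r13 < j" by simp
    then obtain v where v: "j = r13 + v" "0 < v" using less_imp_add_positive by blast
    have "v * n3 = e * n1 + u * n2"
      using \<open>e * n1 + u * n2 + r13 * n3 = j * n3\<close> by (simp add: v algebra_simps)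
    then have "c3 \<le> v" using v by (intro c3_minimal) auto
    then show False using nrm v by (simp add: normal_def)
  next
    case 2
    then obtain u where u: "r13 = j + u" "0 < u" using less_imp_add_positive by blast
    obtain v where v: "i = r12 + v" using 2 le_Suc_ex by blast
    have veq: "v * n2 = e * n1 + u * n3" using bal by (simp add: u v algebra_simps)
    moreover have "0 < u * n3" using u n_order by simp
    ultimately have "0 < v" by (cases v) auto
    then have "c2 \<le> v" using veq by (intro c2_minimal) auto
    then show False using nrm v r_pos by (simp add: normal_def)
  qed
qed

text \<open>After cancelling common factors, one of two distinct monomials of equal weight becomes a pure
  power of one variable. For \<open>y\<close> and \<open>z\<close> this contradicts the minimality of \<open>c\<^sub>2\<close> and \<open>c\<^sub>3\<close>
  directly. By symmetry it is enough to treat the case \<open>a \<le> a'\<close>.\<close>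

lemma normal_unique_aux:
  assumes w: "wt (a, b, c) = wt (a', b', c')" and nrm: "normal (a, b, c)" "normal (a', b', c')"
    and "a \<le> a'"
  shows "a = a' \<and> b = b' \<and> c = c'"
proof -
  obtain k where k: "a' = a + k" using \<open>a \<le> a'\<close> le_Suc_ex by blast
  have n_pos: "0 < n2" "0 < n3" using n_order by auto
  consider "b' \<le> b" "c' \<le> c" | "b < b'" "c' \<le> c" | "b' \<le> b" "c < c'" | "b < b'" "c < c'"
    by linarith
  then show ?thesis
  proof cases
    case 1
    then obtain i j where ij: "b = b' + i" "c = c' + j" by (metis le_Suc_ex)
    have eq: "k * n1 = i * n2 + j * n3" using w by (simp add: k ij algebra_simps)
    have "normal (0, i, j)" using nrm(1) by (auto simp: normal_def ij)
    from normal_no_x_power_of_equal_weight[OF eq this] have "k = 0" .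
    then show ?thesis using eq n_pos by (simp add: k ij)
  next
    case 2
    then obtain i j where ij: "b' = b + i" "c = c' + j" by (metis le_Suc_ex less_imp_le)
    have "j * n3 = k * n1 + i * n2" using w by (simp add: k ij algebra_simps)
    moreover have "j < c3" using nrm(1) by (simp add: normal_def ij)
    ultimately have "j = 0" using c3_minimal[of j k i] by (cases "j = 0") auto
    then show ?thesis using \<open>j * n3 = k * n1 + i * n2\<close> 2 ij n_pos by simp
  next
    case 3
    then obtain i j where ij: "b = b' + i" "c' = c + j" by (metis le_Suc_ex less_imp_le)
    have "i * n2 = k * n1 + j * n3" using w by (simp add: k ij algebra_simps)
    moreover have "i < c2" using nrm(1) by (simp add: normal_def ij)
    ultimately have "i = 0" using c2_minimal[of i k j] by (cases "i = 0") auto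
    then show ?thesis using \<open>i * n2 = k * n1 + j * n3\<close> 3 ij n_pos by simp
  next
    case 4
    then have "b * n2 < b' * n2" "c * n3 < c' * n3" using n_pos by auto
    moreover have "b * n2 + c * n3 = b' * n2 + c' * n3 + k * n1"
      using w by (simp add: k algebra_simps)
    ultimately show ?thesis by linarith
  qed
qed

lemma normal_unique:
  assumes "wt p = wt q" "normal p" "normal q"
  shows "p = q"
proof -
  obtain a b c a' b' c' where pq: "p = (a, b, c)" "q = (a', b', c')"
    by (metis surj_pair)
  show ?thesis
  proof (cases "a \<le> a'")
    case True
    then show ?thesis using normal_unique_aux[of a b c a' b' c'] assms by (simp add: pq)
  next
    case False
    then show ?thesis using normal_unique_aux[of a' b' c' a b c] assms by (simp add: pq)
  qed
qed

section \<open>Rewriting to normal form\<close>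

lemma rewrite_step:
  assumes "\<not> normal (a, b, c)"
  shows "\<exists>a' b' c'. wt (a', b', c') = wt (a, b, c) \<and>
    (a + b + c < a' + b' + c' \<and> monomial (a, b, c) \<in> (candidate :: 'k::field poly3 set) \<or>
     a' + b' + c' = a + b + c \<and> b' < b \<and>
       monomial (a, b, c) - monomial (a', b', c') \<in> (candidate :: 'k poly3 set))"
proof -
  consider "c2 \<le> b" | "c3 \<le> c" | "r12 \<le> b" "r13 \<le> c" using assms by (auto simp: normal_def)
  then show ?thesis
  proof cases
    case 1
    then obtain j where j: "b = c2 + j" using le_Suc_ex by blast
    have "monomial (a, j, c) * (Y ^ c2 - X ^ r21 * Z ^ r23) \<in> (candidate :: 'k poly3 set)"
      unfolding candidate_def by (intro ideal_gen_mult ideal_gen_base) simp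
    then have "monomial (a, b, c) - monomial (a + r21, j, c + r23) \<in> (candidate :: 'k poly3 set)"
      by (simp add: X_power Y_power Z_power monomial_mult right_diff_distrib j add.commute)
    moreover have "wt (a + r21, j, c + r23) = wt (a, b, c)"
      using rel2 by (simp add: j algebra_simps)
    moreover have "a + r21 + j + (c + r23) = a + b + c" "j < b"
      using homogeneous r_pos by (simp_all add: j)
    ultimately show ?thesis by blast
  next
    case 2
    then obtain j where j: "c = c3 + j" using le_Suc_ex by blast
    have "monomial (a, b, j) * Z ^ c3 \<in> (candidate :: 'k poly3 set)"
      unfolding candidate_def by (intro ideal_gen_mult ideal_gen_base) simp
    then have "monomial (a, b, c) \<in> (candidate :: 'k poly3 set)"
      by (simp add: Z_power monomial_mult j add.commute)
    moreover have "wt (a + r31, b + r32, j) = wt (a, b, c)"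
      using rel3 by (simp add: j algebra_simps)
    moreover have "a + b + c < a + r31 + (b + r32) + j"
      using degree_rel3 by (simp add: j)
    ultimately show ?thesis by blast
  next
    case 3
    then obtain i j where ij: "b = r12 + i" "c = r13 + j" by (metis le_Suc_ex)
    have "monomial (a, i, j) * (Y ^ r12 * Z ^ r13) \<in> (candidate :: 'k poly3 set)"
      unfolding candidate_def by (intro ideal_gen_mult ideal_gen_base) simp
    then have "monomial (a, b, c) \<in> (candidate :: 'k poly3 set)"
      by (simp add: Y_power Z_power monomial_mult ij add.commute)
    moreover have "wt (a + c1, i, j) = wt (a, b, c)"
      using rel1 by (simp add: ij algebra_simps)
    moreover have "a + b + c < a + c1 + i + j"
      using degree_rel1 by (simp add: ij)
    ultimately show ?thesis by blast
  qed
qed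

lemma mdeg_le_weight: "mdeg m \<le> wt m"
proof (cases m)
  case (fields a b c)
  have "a * 1 \<le> a * n1" "b * 1 \<le> b * n2" "c * 1 \<le> c * n3"
    using n_order by (intro mult_le_mono; simp)+
  then have "a + b + c \<le> a * n1 + b * n2 + c * n3" by linarith
  then show ?thesis by (simp add: fields)
qed

text \<open>If rewriting \<open>m\<close> to \<open>p\<close> raises the degree at least once, then \<open>m\<close> itself lies in the ideal:
  up to the first rise every step is a congruence. The type argument only names the coefficient field.\<close>

definition is_normal_form :: "'k::field itself \<Rightarrow> nat \<times> nat \<times> nat \<Rightarrow> nat \<times> nat \<times> nat \<Rightarrow> bool" where
  "is_normal_form _ m p \<longleftrightarrow> normal p \<and> wt p = wt m \<and> mdeg m \<le> mdeg p \<and>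
    (if mdeg m < mdeg p then monomial m else monomial m - monomial p) \<in> (candidate :: 'k::field poly3 set)"

text \<open>The degree is bounded by the weight, so it can rise only finitely often; between two rises the
  exponent of \<open>y\<close> falls.\<close>

lemma exists_normal_form: "\<exists>p. is_normal_form TYPE('k::field) m p"
proof (induction m rule: wf_induct_rule[OF wf_measures[of "[\<lambda>m. wt m - mdeg m, \<lambda>m. fst (snd m)]"]])
  case (1 m)
  obtain a b c where m: "m = (a, b, c)" by (metis surj_pair)
  show ?case
  proof (cases "normal m")
    case True
    then have "is_normal_form TYPE('k) m m"
      by (simp add: is_normal_form_def candidate_def ideal_gen_zero)
    then show ?thesis by blast
  next
    case False
    then obtain a' b' c' where s: "wt (a', b', c') = wt m"
      "mdeg m < mdeg (a', b', c') \<and> monomial m \<in> (candidate :: 'k poly3 set) \<or>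
       mdeg (a', b', c') = mdeg m \<and> b' < b \<and>
         monomial m - monomial (a', b', c') \<in> (candidate :: 'k poly3 set)"
      using rewrite_step[of a b c, where 'k = 'k] unfolding m mdeg.simps by blast
    have "((a', b', c'), m) \<in> measures [\<lambda>m. wt m - mdeg m, \<lambda>m. fst (snd m)]"
      using s mdeg_le_weight[of "(a', b', c')"] by (auto simp: m)
    then obtain p where p: "is_normal_form TYPE('k) (a', b', c') p"
      using 1 by blast
    have "is_normal_form TYPE('k) m p"
      using s(2)
    proof (elim disjE conjE)
      assume "mdeg m < mdeg (a', b', c')" "monomial m \<in> (candidate :: 'k poly3 set)"
      then show ?thesis using p s(1) unfolding is_normal_form_def by auto
    next
      assume h: "mdeg (a', b', c') = mdeg m" "b' < b"
        "monomial m - monomial (a', b', c') \<in> (candidate :: 'k poly3 set)"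
      let ?rest = "if mdeg m < mdeg p then monomial (a', b', c') else monomial (a', b', c') - monomial p"
      have "?rest \<in> (candidate :: 'k poly3 set)"
        using p h(1) unfolding is_normal_form_def by auto
      then have "(monomial m - monomial (a', b', c')) + ?rest \<in> (candidate :: 'k poly3 set)"
        using h(3) unfolding candidate_def by (intro ideal_gen_add)
      then have "(if mdeg m < mdeg p then monomial m else monomial m - monomial p)
          \<in> (candidate :: 'k poly3 set)"
        by (auto split: if_splits)
      then show ?thesis using p s(1) h(1) unfolding is_normal_form_def by auto
    qed
    then show ?thesis by blast
  qed
qed

section \<open>Comparison of the two ideals\<close>

lemma initial_form_in_candidate:
  fixes f :: "'k::field poly3"
  assumes "f \<in> toric_ideal n1 n2 n3"
  shows "initial_form f \<in> candidate"
proof -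
  define nf where "nf m = (SOME p. is_normal_form TYPE('k) m p)" for m
  have nf: "is_normal_form TYPE('k) m (nf m)" for m
    unfolding nf_def using exists_normal_form by (rule someI_ex)
  define d where "d = order3 f"
  define K where "K = {m \<in> Poly_Mapping.keys f. mdeg m = d}"
  define top where "top m \<longleftrightarrow> mdeg (nf m) = d" for m
  let ?c = "Poly_Mapping.lookup f"
  have "finite K" by (simp add: K_def)
  \<comment> \<open>\<open>R\<close> is the result of reducing the initial form of \<open>f\<close> modulo the ideal. A term whose normal form
    has degree above \<open>d\<close> lies in the ideal and contributes nothing.\<close>
  define R where "R = (\<Sum>m\<in>K. if top m then Poly_Mapping.single (nf m) (?c m) else 0)"
  have "(\<Sum>m\<in>K. Poly_Mapping.single m (?c m) - (if top m then Poly_Mapping.single (nf m) (?c m) else 0))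
      \<in> candidate"
    unfolding candidate_def
  proof (rule ideal_gen_sum, fold candidate_def)
    fix m assume "m \<in> K"
    then have "(if top m then monomial m - monomial (nf m) else monomial m) \<in> (candidate :: 'k poly3 set)"
      using nf[of m] by (auto simp: is_normal_form_def top_def K_def split: if_splits)
    then have "Poly_Mapping.single 0 (?c m) * (if top m then monomial m - monomial (nf m) else monomial m)
        \<in> candidate"
      unfolding candidate_def by (rule ideal_gen_mult)
    then show "Poly_Mapping.single m (?c m) - (if top m then Poly_Mapping.single (nf m) (?c m) else 0)
        \<in> candidate"
      by (simp add: right_diff_distrib mult_single split: if_splits)
  qed
  then have "initial_form f - R \<in> candidate"
    by (simp add: R_def initial_form_def hom_component_def K_def d_def sum_subtractf)
  moreover have "R = 0"
  proof (rule poly_mapping_eqI)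
    fix p
    have lookup_R: "Poly_Mapping.lookup R p = (\<Sum>m \<in> {m \<in> K. top m \<and> nf m = p}. ?c m)"
      using \<open>finite K\<close> unfolding R_def lookup_sum
      by (subst sum.inter_filter) (auto intro!: sum.cong simp: lookup_single when_def)
    show "Poly_Mapping.lookup R p = Poly_Mapping.lookup 0 p"
    proof (cases "normal p \<and> mdeg p = d")
      case True
      have "m \<in> K \<and> top m \<and> nf m = p \<longleftrightarrow> m \<in> Poly_Mapping.keys f \<and> wt m = wt p" for m
      proof
        assume "m \<in> K \<and> top m \<and> nf m = p"
        then show "m \<in> Poly_Mapping.keys f \<and> wt m = wt p"
          using nf[of m] by (auto simp: K_def is_normal_form_def)
      next
        assume m: "m \<in> Poly_Mapping.keys f \<and> wt m = wt p"
        then have "nf m = p"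
          using nf[of m] True by (intro normal_unique) (auto simp: is_normal_form_def)
        \<comment> \<open>\<open>d = order3 f \<le> mdeg m \<le> mdeg p = d\<close>\<close>
        moreover have "mdeg m = d"
          using nf[of m] order3_le_mdeg[of m f] m True \<open>nf m = p\<close>
          by (auto simp: is_normal_form_def d_def)
        ultimately show "m \<in> K \<and> top m \<and> nf m = p"
          using m True by (simp add: K_def top_def)
      qed
      then have "Poly_Mapping.lookup R p = coeff (subst_t n1 n2 n3 f) (wt p)"
        unfolding lookup_R coeff_subst_t by simp
      then show ?thesis using assms by (simp add: toric_ideal_def)
    next
      case False
      have "m \<notin> {m \<in> K. top m \<and> nf m = p}" for m
        using False nf[of m] by (auto simp: top_def is_normal_form_def)
      then have none: "{m \<in> K. top m \<and> nf m = p} = {}" by blast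
      show ?thesis unfolding lookup_R none by simp
    qed
  qed
  ultimately show ?thesis by simp
qed

lemma candidate_subset_initial_ideal:
  "candidate \<subseteq> initial_ideal (toric_ideal n1 n2 n3 :: 'k::field poly3 set)"
proof -
  let ?I = "initial_ideal (toric_ideal n1 n2 n3 :: 'k poly3 set)"
  have "initial_form (monomial (0, r12, r13) - monomial (c1, 0, 0)) \<in> ?I"
    using rel1 r_pos by (intro binomial_initial_form_in_initial_ideal) auto
  then have g1: "Y ^ r12 * Z ^ r13 \<in> ?I"
    using degree_rel1 r_pos by (simp add: initial_form_binomial Y_power Z_power monomial_mult)
  have "initial_form (monomial (0, c2, 0) - monomial (r21, 0, r23)) \<in> ?I"
    using rel2 r_pos by (intro binomial_initial_form_in_initial_ideal) auto
  then have g2: "Y ^ c2 - X ^ r21 * Z ^ r23 \<in> ?I"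
    using homogeneous r_pos
    by (simp add: initial_form_binomial X_power Y_power Z_power monomial_mult)
  have "initial_form (monomial (0, 0, c3) - monomial (r31, r32, 0)) \<in> ?I"
    using rel3 r_pos by (intro binomial_initial_form_in_initial_ideal) auto
  then have g3: "Z ^ c3 \<in> ?I"
    using degree_rel3 r_pos by (simp add: initial_form_binomial Z_power)
  show ?thesis
    unfolding candidate_def using g1 g2 g3 unfolding initial_ideal_def
    by (intro ideal_gen_subset) simp
qed

lemma initial_ideal_eq_candidate:
  "initial_ideal (toric_ideal n1 n2 n3 :: 'k::field poly3 set) = candidate"
proof
  show "initial_ideal (toric_ideal n1 n2 n3 :: 'k poly3 set) \<subseteq> candidate"
    using initial_form_in_candidate unfolding initial_ideal_def candidate_def
    by (intro ideal_gen_subset) blast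
qed (rule candidate_subset_initial_ideal)

end

theorem lemma4p4:
  fixes n1 n2 n3 c1 c2 c3 r12 r13 r21 r23 r31 r32 :: nat
  assumes "0 < n1" "n1 < n2" "n2 < n3"
    and "Gcd {n1, n2, n3} = 1"
    and "minimally_generates {n1, n2, n3} (semigroup_gen {n1, n2, n3})"
    and "c1 = least_mult n1 {n2, n3}"
    and "c2 = least_mult n2 {n1, n3}"
    and "c3 = least_mult n3 {n1, n2}"
    and "c1 * n1 = r12 * n2 + r13 * n3"
    and "c2 * n2 = r21 * n1 + r23 * n3"
    and "c3 * n3 = r31 * n1 + r32 * n2"
    and "r12 \<noteq> 0" "r13 \<noteq> 0" "r21 \<noteq> 0" "r23 \<noteq> 0" "r31 \<noteq> 0" "r32 \<noteq> 0"
    and "c2 = r21 + r23"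
  shows "initial_ideal (toric_ideal n1 n2 n3 :: 'k::field poly3 set) =
    ideal_gen {Y ^ r12 * Z ^ r13, Y ^ c2 - X ^ r21 * Z ^ r23, Z ^ c3}"
proof -
  interpret homogeneous_second_relation n1 n2 n3 c1 c2 c3 r12 r13 r21 r23 r31 r32
  proof
    show "c1 \<le> a" if "0 < a" "a * n1 = b * n2 + c * n3" for a b c
      using least_mult_le[OF that] assms by simp
    show "c2 \<le> b" if "0 < b" "b * n2 = a * n1 + c * n3" for a b c
      using least_mult_le[OF that] assms by simp
    show "c3 \<le> c" if "0 < c" "c * n3 = a * n1 + b * n2" for a b c
      using least_mult_le[OF that] assms by simp
  qed (use assms in simp_all)
  show ?thesis using initial_ideal_eq_candidate unfolding candidate_def .
qed

end
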